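(* Let $M,N_a,K\ge 1$ be integers, $p_1,\dots,p_K>0$, $\sigma_n^2>0$, let $\mathbf{h}_1,\dots,\mathbf{h}_K\in\mathbb{C}^{MN_a\times 1}$ and $\mathbf{H}_1,\dots,\mathbf{H}_M\in\mathbb{C}^{MN_a\times N_a}$. For any given AP mode selection $\{x_m^C,x_m^J\}_{m=1}^M$ with $x_m^C,x_m^J\in\{0,1\}$, $x_m^C+x_m^J=1$, and any given AN covariance matrices $\mathbf{V}_1,\dots,\mathbf{V}_M\in\mathbb{C}^{N_a\times N_a}$ (Hermitian positive semidefinite), and for every $k\in\{1,\dots,K\}$, the optimal receive combiner for the $k$-th UAV, i.e. a maximizer of the SINR $\gamma_k(\mathbf{u}_k)$ over $\mathbf{u}_k\in\mathbb{C}^{MN_a\times 1}$, is $$\mathbf{u}_k^\ast=\left(\sum_{i\neq k}p_i\,\mathbf{S}_c\mathbf{h}_i\mathbf{h}_i^H\mathbf{S}_c+\sum_{m=1}^{M}x_m^J\,\mathbf{S}_c\mathbf{H}_m\mathbf{V}_m\mathbf{H}_m^H\mathbf{S}_c+\sigma_n^2\mathbf{I}\right)^{-1}\mathbf{S}_c\mathbf{h}_k .$$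
   Context: There are $M$ access points (APs) with $N_a$ antennas each and $K$ UAVs with transmit powers $p_k$. The binary variables $x_m^C,x_m^J$ indicate whether AP $m$ receives ($x_m^C=1$) or transmits artificial noise (AN) with covariance $\mathbf{V}_m$ ($x_m^J=1$). The mode-selection matrix is the block-diagonal matrix $$\mathbf{S}_c=\mathrm{diag}\{x_1^C\mathbf{I}_{N_a},\dots,x_M^C\mathbf{I}_{N_a}\}\in\mathbb{C}^{MN_a\times MN_a}.$$ The vector $\mathbf{h}_k$ is the stacked channel from UAV $k$ to all APs, and $\mathbf{H}_m$ is the stacked interference channel matrix from AP $m$ to all APs. For a receive combining vector $\mathbf{u}_k\in\mathbb{C}^{MN_a\times1}$, the SINR (signal-to-interference-plus-noise ratio) of UAV $k$ is $$\gamma_k(\mathbf{u}_k)=\frac{p_k\left|\mathbf{u}_k^H\mathbf{S}_c\mathbf{h}_k\right|^2}{\sum_{i\neq k}p_i\left|\mathbf{u}_k^H\mathbf{S}_c\mathbf{h}_i\right|^2+\sum_{m=1}^{M}x_m^J\,\mathbf{u}_k^H\mathbf{S}_c\mathbf{H}_m\mathbf{V}_m\mathbf{H}_m^H\mathbf{S}_c\mathbf{u}_k+\sigma_n^2\,\mathbf{u}_k^H\mathbf{S}_c\mathbf{u}_k}.$$ When $\mathbf{S}_c\mathbf{u}_k=\mathbf{0}$ (numerator and denominator both vanish), $\gamma_k(\mathbf{u}_k)$ is taken to be $0$. Sums over $i\ne k$ range over $i\in\{1,\dots,K\}\setminus\{k\}$. $(\cdot)^H$ is the conjugate transpose. *)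

theory Defs
  imports "HOL-Analysis.Analysis"
begin

text \<open>
  The finite types \<^typ>\<open>'m\<close>, \<^typ>\<open>'n\<close> and \<^typ>\<open>'k\<close> index the access points, the antennas of
  one access point and the UAVs, so \<open>M\<close>, \<open>N\<^sub>a\<close>, \<open>K\<close> are their cardinalities. Stacked vectors
  over all access points are indexed by \<^typ>\<open>'m \<times> 'n\<close>: the index \<open>(m, a)\<close> is antenna \<open>a\<close> of
  access point \<open>m\<close>.
\<close>

definition herm_prod :: "complex ^ 'i \<Rightarrow> complex ^ 'i \<Rightarrow> complex" where
  "herm_prod u v = (\<Sum>i\<in>UNIV. cnj (u $ i) * v $ i)"

definition conj_transpose :: "complex ^ 'j ^ 'i \<Rightarrow> complex ^ 'i ^ 'j" where
  "conj_transpose A = (\<chi> i j. cnj (A $ j $ i))"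

definition herm_outer :: "complex ^ 'i \<Rightarrow> complex ^ 'j \<Rightarrow> complex ^ 'j ^ 'i" where
  "herm_outer u v = (\<chi> i j. u $ i * cnj (v $ j))"

definition hermitian_psd :: "complex ^ 'i ^ 'i \<Rightarrow> bool" where
  "hermitian_psd A \<longleftrightarrow> conj_transpose A = A \<and> (\<forall>z. 0 \<le> Re (herm_prod z (A *v z)))"

definition mode_selection :: "('m::finite \<Rightarrow> real) \<Rightarrow> complex ^ ('m \<times> 'n::finite) ^ ('m \<times> 'n)" where
  "mode_selection xC = (\<chi> i j. if i = j then complex_of_real (xC (fst i)) else 0)"

text \<open>
  The quadratic forms in the denominator are real whenever the matrices \<open>V m\<close> are Hermitian;
  \<^const>\<open>Re\<close> only turns them into elements of \<^typ>\<open>real\<close>.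
\<close>

definition sinr ::
  "('k::finite \<Rightarrow> real) \<Rightarrow> real \<Rightarrow> ('k \<Rightarrow> complex ^ ('m::finite \<times> 'n::finite))
    \<Rightarrow> ('m \<Rightarrow> complex ^ 'n ^ ('m \<times> 'n)) \<Rightarrow> ('m \<Rightarrow> real) \<Rightarrow> ('m \<Rightarrow> real)
    \<Rightarrow> ('m \<Rightarrow> complex ^ 'n ^ 'n) \<Rightarrow> 'k \<Rightarrow> complex ^ ('m \<times> 'n) \<Rightarrow> real" where
  "sinr p \<sigma> h H xC xJ V k u =
    (let S = mode_selection xC in
      if S *v u = 0 then 0
      else p k * (cmod (herm_prod u (S *v h k)))\<^sup>2 /
        ((\<Sum>i\<in>UNIV - {k}. p i * (cmod (herm_prod u (S *v h i)))\<^sup>2)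
          + (\<Sum>m\<in>UNIV. xJ m *
              Re (herm_prod u ((S ** H m ** V m ** conj_transpose (H m) ** S) *v u)))
          + \<sigma>\<^sup>2 * Re (herm_prod u (S *v u))))"

definition interference_noise_cov ::
  "('k::finite \<Rightarrow> real) \<Rightarrow> real \<Rightarrow> ('k \<Rightarrow> complex ^ ('m::finite \<times> 'n::finite))
    \<Rightarrow> ('m \<Rightarrow> complex ^ 'n ^ ('m \<times> 'n)) \<Rightarrow> ('m \<Rightarrow> real) \<Rightarrow> ('m \<Rightarrow> real)
    \<Rightarrow> ('m \<Rightarrow> complex ^ 'n ^ 'n) \<Rightarrow> 'k \<Rightarrow> complex ^ ('m \<times> 'n) ^ ('m \<times> 'n)" where
  "interference_noise_cov p \<sigma> h H xC xJ V k =
    (let S = mode_selection xC in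
      (\<Sum>i\<in>UNIV - {k}. p i *\<^sub>R (S ** herm_outer (h i) (h i) ** S))
        + (\<Sum>m\<in>UNIV. xJ m *\<^sub>R (S ** H m ** V m ** conj_transpose (H m) ** S))
        + \<sigma>\<^sup>2 *\<^sub>R mat 1)"

end

theory Submission
  imports Defs
begin

text \<open>
  Put \<open>g = S h\<^sub>k\<close> and let \<open>B\<close> be the matrix to be inverted. Since \<open>S\<close> is an orthogonal projection,
  \<open>B = S N S + \<sigma>\<^sup>2 I\<close> with \<open>N\<close> positive semidefinite, so \<open>B\<close> is positive definite and the SINR of
  \<open>u\<close> is the generalised Rayleigh quotient \<open>p\<^sub>k |\<langle>v, g\<rangle>|\<^sup>2 / \<langle>v, B v\<rangle>\<close> at \<open>v = S u\<close>. With
  \<open>w = B\<^sup>-\<^sup>1 g\<close>, the Cauchy-Schwarz inequality for the form \<open>B\<close> bounds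
  \<open>|\<langle>v, g\<rangle>|\<^sup>2 = |\<langle>v, B w\<rangle>|\<^sup>2\<close> by \<open>\<langle>v, B v\<rangle> \<langle>w, B w\<rangle>\<close>, with equality at \<open>v = w\<close>. As \<open>B\<close> commutes with
  \<open>S\<close> and \<open>S g = g\<close>, also \<open>S w = w\<close>, so that the bound is attained at \<open>u = w\<close>.
\<close>

subsection \<open>The Hermitian product\<close>

lemma herm_prod_add_right: "herm_prod u (v + w) = herm_prod u v + herm_prod u w"
  by (simp add: herm_prod_def sum.distrib ring_distribs)

lemma herm_prod_diff_right: "herm_prod u (v - w) = herm_prod u v - herm_prod u w"
  by (simp add: herm_prod_def sum_subtractf ring_distribs)

lemma herm_prod_diff_left: "herm_prod (u - v) w = herm_prod u w - herm_prod v w"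
  by (simp add: herm_prod_def sum_subtractf ring_distribs)

lemma herm_prod_smult_right: "herm_prod u (c *s v) = c * herm_prod u v"
  by (simp add: herm_prod_def sum_distrib_left mult_ac)

lemma herm_prod_smult_left: "herm_prod (c *s u) v = cnj c * herm_prod u v"
  by (simp add: herm_prod_def sum_distrib_left mult_ac)

lemma herm_prod_scaleR_right: "herm_prod u (c *\<^sub>R v) = c *\<^sub>R herm_prod u v"
  by (simp add: herm_prod_def scaleR_sum_right)

lemma herm_prod_zero_right [simp]: "herm_prod u 0 = 0"
  by (simp add: herm_prod_def)

lemma herm_prod_sum_right: "herm_prod u (\<Sum>i\<in>I. f i) = (\<Sum>i\<in>I. herm_prod u (f i))"
  by (induction I rule: infinite_finite_induct) (simp_all add: herm_prod_add_right)

lemma cnj_herm_prod: "cnj (herm_prod u v) = herm_prod v u"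
  by (simp add: herm_prod_def mult.commute)

lemma Re_herm_prod_self_pos:
  assumes "u \<noteq> 0" shows "0 < Re (herm_prod u u)"
proof -
  have eq: "Re (herm_prod u u) = (\<Sum>i\<in>UNIV. (cmod (u $ i))\<^sup>2)"
    by (simp add: herm_prod_def cmod_power2) (simp add: power2_eq_square)
  obtain i where "u $ i \<noteq> 0"
    using assms by (auto simp: vec_eq_iff)
  then show ?thesis
    unfolding eq by (intro sum_pos2[of _ i]) auto
qed

lemma herm_prod_matrix: "herm_prod u (A *v v) = herm_prod (conj_transpose A *v u) v"
proof -
  have "herm_prod u (A *v v) = (\<Sum>i\<in>UNIV. \<Sum>j\<in>UNIV. cnj (u $ i) * (A $ i $ j * v $ j))"
    by (simp add: herm_prod_def matrix_vector_mult_def sum_distrib_left)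
  also have "\<dots> = (\<Sum>j\<in>UNIV. \<Sum>i\<in>UNIV. cnj (u $ i) * (A $ i $ j * v $ j))"
    by (rule sum.swap)
  also have "\<dots> = herm_prod (conj_transpose A *v u) v"
    by (simp add: herm_prod_def matrix_vector_mult_def conj_transpose_def sum_distrib_left
        sum_distrib_right mult_ac)
  finally show ?thesis .
qed

lemma herm_outer_mult_vector: "herm_outer u v *v w = herm_prod v w *s u"
  by (simp add: vec_eq_iff herm_outer_def herm_prod_def matrix_vector_mult_def
      sum_distrib_left mult_ac)

subsection \<open>Sums, multiples and conjugate transposes of matrices\<close>

lemma matrix_add_rdistrib: "(A + B) ** C = A ** C + B ** C"
  by (simp add: matrix_matrix_mult_def vec_eq_iff sum.distrib distrib_right)

lemma matrix_sum_mult: "(\<Sum>i\<in>I. f i) ** A = (\<Sum>i\<in>I. f i ** A)"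
  for f :: "'a \<Rightarrow> 'b::comm_ring_1 ^ 'n ^ 'm"
  by (induction I rule: infinite_finite_induct)
    (simp_all add: matrix_add_rdistrib)

lemma matrix_mult_sum: "A ** (\<Sum>i\<in>I. f i) = (\<Sum>i\<in>I. A ** f i)"
  for A :: "'b::comm_ring_1 ^ 'n ^ 'm"
  by (induction I rule: infinite_finite_induct)
    (simp_all add: matrix_add_ldistrib)

lemma matrix_sum_mult_vector: "(\<Sum>i\<in>I. f i) *v x = (\<Sum>i\<in>I. f i *v x)"
  for f :: "'a \<Rightarrow> 'b::comm_ring_1 ^ 'n ^ 'm"
  by (induction I rule: infinite_finite_induct) (simp_all add: matrix_vector_mult_add_rdistrib)

lemma scaleR_matrix_mult_vector: "(c *\<^sub>R A) *v x = c *\<^sub>R (A *v x)"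
  for A :: "complex ^ 'n ^ 'm"
  by (simp add: matrix_vector_mult_def vec_eq_iff scaleR_sum_right)

lemma conj_transpose_add: "conj_transpose (A + B) = conj_transpose A + conj_transpose B"
  by (simp add: conj_transpose_def vec_eq_iff)

lemma conj_transpose_scaleR: "conj_transpose (c *\<^sub>R A) = c *\<^sub>R conj_transpose A"
  by (simp add: conj_transpose_def vec_eq_iff)

lemma conj_transpose_mult: "conj_transpose (A ** B) = conj_transpose B ** conj_transpose A"
  by (simp add: conj_transpose_def matrix_matrix_mult_def vec_eq_iff mult.commute)

lemma conj_transpose_conj_transpose [simp]: "conj_transpose (conj_transpose A) = A"
  by (simp add: conj_transpose_def vec_eq_iff)

subsection \<open>Positive semidefinite matrices\<close>

lemma hermitian_psd_zero: "hermitian_psd 0"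
  by (simp add: hermitian_psd_def conj_transpose_def vec_eq_iff)

lemma hermitian_psd_add: "hermitian_psd A \<Longrightarrow> hermitian_psd B \<Longrightarrow> hermitian_psd (A + B)"
  by (simp add: hermitian_psd_def conj_transpose_add matrix_vector_mult_add_rdistrib
      herm_prod_add_right)

lemma hermitian_psd_scaleR: "hermitian_psd A \<Longrightarrow> 0 \<le> c \<Longrightarrow> hermitian_psd (c *\<^sub>R A)"
  by (simp add: hermitian_psd_def conj_transpose_scaleR scaleR_matrix_mult_vector
      herm_prod_scaleR_right)

lemma hermitian_psd_sum:
  "(\<And>i. i \<in> I \<Longrightarrow> hermitian_psd (f i)) \<Longrightarrow> hermitian_psd (\<Sum>i\<in>I. f i)"
  by (induction I rule: infinite_finite_induct)
    (simp_all add: hermitian_psd_zero hermitian_psd_add)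

text \<open>Applying the rank-one matrix leaves a number times its own conjugate. This turns each
  covariance term of an interfering UAV into a squared modulus of the SINR.\<close>

lemma herm_prod_outer: "herm_prod u (herm_outer v v *v u) = complex_of_real ((cmod (herm_prod u v))\<^sup>2)"
  by (metis cnj_herm_prod complex_norm_square herm_outer_mult_vector herm_prod_smult_right
      mult.commute)

lemma hermitian_psd_outer: "hermitian_psd (herm_outer v v)"
  unfolding hermitian_psd_def herm_prod_outer
  by (simp add: conj_transpose_def herm_outer_def vec_eq_iff mult.commute)

text \<open>Moving the left factor across the product as its adjoint leaves the form of
  \<open>B\<close> at a transformed vector, so congruence preserves semidefiniteness.\<close>

lemma herm_prod_congruence:
  "herm_prod u ((A ** B ** conj_transpose A) *v v)
    = herm_prod (conj_transpose A *v u) (B *v (conj_transpose A *v v))"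
  by (simp add: herm_prod_matrix[of _ A] flip: matrix_vector_mul_assoc)

lemma hermitian_psd_congruence:
  "hermitian_psd B \<Longrightarrow> hermitian_psd (A ** B ** conj_transpose A)"
  by (simp add: hermitian_psd_def herm_prod_congruence)
    (simp add: conj_transpose_mult matrix_mul_assoc)

lemma hermitian_psd_mat_1: "hermitian_psd (mat 1)"
proof -
  have "0 \<le> Re (herm_prod z z)" for z :: "complex ^ 'n"
    using Re_herm_prod_self_pos[of z] by (cases "z = 0") auto
  then show ?thesis
    by (auto simp: hermitian_psd_def) (simp add: conj_transpose_def mat_def vec_eq_iff)
qed

lemma hermitian_psd_Cauchy_Schwarz:
  assumes "hermitian_psd A" and pos: "0 < Re (herm_prod w (A *v w))"
  shows "(cmod (herm_prod v (A *v w)))\<^sup>2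
    \<le> Re (herm_prod v (A *v v)) * Re (herm_prod w (A *v w))"
proof -
  have sym: "cnj (herm_prod x (A *v y)) = herm_prod y (A *v x)" for x y
    using assms(1) by (metis cnj_herm_prod hermitian_psd_def herm_prod_matrix)
  define a where "a = herm_prod w (A *v v)"
  define c where "c = Re (herm_prod w (A *v w))"
  have a': "herm_prod v (A *v w) = cnj a"
    by (simp add: a_def sym)
  \<comment> \<open>By symmetry this value equals its own conjugate, hence is real.\<close>
  have c: "herm_prod w (A *v w) = complex_of_real c"
    using sym[of w w] by (simp add: c_def complex_eq_iff)
  have "c > 0"
    using pos by (simp add: c_def)
  \<comment> \<open>The coefficient \<open>a / c\<close> makes the product of \<open>w\<close> with
    \<open>A *v ?z\<close> vanish: \<open>?z\<close> is \<open>v\<close> minus its projection onto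
    \<open>w\<close> with respect to the form of \<open>A\<close>. Nonnegativity of the form at
    \<open>?z\<close> is the claim.\<close>
  let ?z = "v - (a / c) *s w"
  have "herm_prod ?z (A *v ?z)
      = herm_prod v (A *v v) - (a / c) * cnj a - cnj (a / c) * a + cnj (a / c) * (a / c) * c"
    by (simp add: matrix_vector_mult_diff_distrib vector_scalar_commute herm_prod_diff_right
        herm_prod_diff_left herm_prod_smult_left herm_prod_smult_right a' c a_def[symmetric]
        algebra_simps)
  also have "\<dots> = herm_prod v (A *v v) - (a * cnj a) / c"
    using \<open>c > 0\<close> by (simp add: field_simps)
  also have "\<dots> = herm_prod v (A *v v) - complex_of_real ((cmod a)\<^sup>2 / c)"
    by (simp only: complex_norm_square[symmetric] of_real_divide)
  finally have "Re (herm_prod ?z (A *v ?z)) = Re (herm_prod v (A *v v)) - (cmod a)\<^sup>2 / c"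
    by simp
  moreover have "0 \<le> Re (herm_prod ?z (A *v ?z))"
    using assms(1) by (simp add: hermitian_psd_def)
  ultimately have "(cmod a)\<^sup>2 / c \<le> Re (herm_prod v (A *v v))"
    by linarith
  then have "(cmod a)\<^sup>2 \<le> Re (herm_prod v (A *v v)) * c"
    using \<open>c > 0\<close> by (simp add: pos_divide_le_eq)
  then show ?thesis
    by (simp add: a' c_def)
qed

text \<open>The form vanishes at a kernel vector, so the kernel is trivial, which suffices for a
  square matrix.\<close>

lemma invertible_if_positive_definite:
  assumes "\<And>z. z \<noteq> 0 \<Longrightarrow> 0 < Re (herm_prod z (A *v z))"
  shows "invertible A"
  unfolding invertible_left_inverse matrix_left_invertible_ker
  using assms by (metis herm_prod_zero_right less_irrefl zero_complex.sel(1))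

lemma matrix_inv_mult_vector:
  assumes "invertible A"
  shows "matrix_inv A *v (A *v x) = x" "A *v (matrix_inv A *v x) = x"
proof -
  \<comment> \<open>\<open>matrix_inv\<close> is a choice among two-sided inverses; invertibility
    says that one exists.\<close>
  have "A ** matrix_inv A = mat 1 \<and> matrix_inv A ** A = mat 1"
    using assms unfolding invertible_def matrix_inv_def by (rule someI_ex)
  then show "matrix_inv A *v (A *v x) = x" "A *v (matrix_inv A *v x) = x"
    by (simp_all add: matrix_vector_mul_assoc)
qed

lemma positive_definite_Rayleigh_le:
  assumes "hermitian_psd A" and pd: "\<And>z. z \<noteq> 0 \<Longrightarrow> 0 < Re (herm_prod z (A *v z))"
    and "v \<noteq> 0" "w \<noteq> 0"
  shows "(cmod (herm_prod v (A *v w)))\<^sup>2 / Re (herm_prod v (A *v v))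
    \<le> (cmod (herm_prod w (A *v w)))\<^sup>2 / Re (herm_prod w (A *v w))"
proof -
  let ?q = "herm_prod w (A *v w)"
  have pos: "0 < Re ?q" "0 < Re (herm_prod v (A *v v))"
    using assms by auto
  have "(cmod (herm_prod v (A *v w)))\<^sup>2 / Re (herm_prod v (A *v v)) \<le> Re ?q"
    using hermitian_psd_Cauchy_Schwarz[OF assms(1) pos(1), of v] pos(2)
    by (simp add: field_simps)
  also have "\<dots> = (Re ?q)\<^sup>2 / Re ?q"
    by (simp add: power2_eq_square)
  \<comment> \<open>A real part is at most the modulus, so the chain closes without showing that
    \<open>?q\<close> is real.\<close>
  also have "\<dots> \<le> (cmod ?q)\<^sup>2 / Re ?q"
    using pos(1) by (intro divide_right_mono power_mono complex_Re_le_cmod) auto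
  finally show ?thesis .
qed

subsection \<open>The SINR as a generalised Rayleigh quotient\<close>

lemma conj_transpose_mode_selection: "conj_transpose (mode_selection xC) = mode_selection xC"
  by (simp add: conj_transpose_def mode_selection_def vec_eq_iff)

lemma mode_selection_mult_vector: "(mode_selection xC *v u) $ i = xC (fst i) * u $ i"
  by (simp add: mode_selection_def matrix_vector_mult_def mult_delta_left)

lemma mode_selection_idem:
  assumes "\<And>m. xC m \<in> {0, 1}"
  shows "mode_selection xC *v (mode_selection xC *v u) = mode_selection xC *v u"
proof -
  have "xC m * xC m = xC m" for m
    using assms[of m] by auto
  then show ?thesis
    by (simp add: vec_eq_iff mode_selection_mult_vector mult.assoc[symmetric] flip: of_real_mult)
qed

text \<open>The covariance before mode selection and without noise, the matrix called N in the
  overview.\<close>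

definition interference_cov ::
  "('k::finite \<Rightarrow> real) \<Rightarrow> ('k \<Rightarrow> complex ^ ('m::finite \<times> 'n::finite))
    \<Rightarrow> ('m \<Rightarrow> complex ^ 'n ^ ('m \<times> 'n)) \<Rightarrow> ('m \<Rightarrow> real)
    \<Rightarrow> ('m \<Rightarrow> complex ^ 'n ^ 'n) \<Rightarrow> 'k \<Rightarrow> complex ^ ('m \<times> 'n) ^ ('m \<times> 'n)" where
  "interference_cov p h H xJ V k =
    (\<Sum>i\<in>UNIV - {k}. p i *\<^sub>R herm_outer (h i) (h i))
      + (\<Sum>m\<in>UNIV. xJ m *\<^sub>R (H m ** V m ** conj_transpose (H m)))"

lemma hermitian_psd_interference_cov:
  assumes "\<And>i. 0 \<le> p i" "\<And>m. 0 \<le> xJ m" "\<And>m. hermitian_psd (V m)"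
  shows "hermitian_psd (interference_cov p h H xJ V k)"
  unfolding interference_cov_def using assms
  by (intro hermitian_psd_add hermitian_psd_sum hermitian_psd_scaleR hermitian_psd_outer
      hermitian_psd_congruence)

text \<open>Bilinearity pulls the mode selection out of both sums. This form shows both positive
  definiteness and commutation with the mode selection.\<close>

lemma interference_noise_cov_eq:
  "interference_noise_cov p \<sigma> h H xC xJ V k
    = mode_selection xC ** interference_cov p h H xJ V k ** mode_selection xC + \<sigma>\<^sup>2 *\<^sub>R mat 1"
  by (simp add: interference_noise_cov_def interference_cov_def Let_def matrix_add_ldistrib
      matrix_add_rdistrib matrix_mult_sum matrix_sum_mult matrix_scalar_ac matrix_mul_assoc
      flip: scalar_matrix_assoc)

text \<open>The quotient is taken at \<open>S *v u\<close> rather than \<open>u\<close> so that the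
  noise term matches: the identity in \<open>B\<close> then contributes the product of
  \<open>S *v u\<close> with itself, which is that of \<open>u\<close> with
  \<open>S *v u\<close>.\<close>

lemma sinr_eq_Rayleigh:
  fixes p \<sigma> h H xC xJ V k
  defines "S \<equiv> mode_selection xC" and "B \<equiv> interference_noise_cov p \<sigma> h H xC xJ V k"
  assumes "\<And>m. xC m \<in> {0, 1}" and "S *v u \<noteq> 0"
  shows "sinr p \<sigma> h H xC xJ V k u
    = p k * ((cmod (herm_prod (S *v u) (S *v h k)))\<^sup>2 / Re (herm_prod (S *v u) (B *v (S *v u))))"
proof -
  have SS: "S *v (S *v x) = S *v x" for x
    unfolding S_def using assms(3) by (rule mode_selection_idem)
  \<comment> \<open>As a rewrite rule this collects every \<open>S\<close> in the left argument,
    where \<open>SS\<close> merges repetitions.\<close>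
  have adj: "herm_prod x (S *v y) = herm_prod (S *v x) y" for x y
    by (simp add: S_def herm_prod_matrix[of x] conj_transpose_mode_selection)
  have "Re (herm_prod (S *v u) (B *v (S *v u)))
      = (\<Sum>i\<in>UNIV - {k}. p i * (cmod (herm_prod u (S *v h i)))\<^sup>2)
        + (\<Sum>m\<in>UNIV. xJ m * Re (herm_prod u ((S ** H m ** V m ** conj_transpose (H m) ** S) *v u)))
        + \<sigma>\<^sup>2 * Re (herm_prod u (S *v u))"
    by (simp add: B_def interference_noise_cov_eq interference_cov_def S_def[symmetric]
        matrix_vector_mult_add_rdistrib matrix_sum_mult_vector scaleR_matrix_mult_vector
        herm_prod_add_right herm_prod_sum_right herm_prod_scaleR_right herm_prod_outer
        adj SS flip: matrix_vector_mul_assoc)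
  then show ?thesis
    using assms(4) by (simp add: sinr_def Let_def S_def[symmetric] adj SS)
qed

theorem proposition1:
  fixes p :: "'k::finite \<Rightarrow> real" and \<sigma> :: real
    and h :: "'k \<Rightarrow> complex ^ ('m::finite \<times> 'n::finite)"
    and H :: "'m \<Rightarrow> complex ^ 'n ^ ('m \<times> 'n)"
    and xC xJ :: "'m \<Rightarrow> real"
    and V :: "'m \<Rightarrow> complex ^ 'n ^ 'n"
    and k :: 'k
  assumes "\<And>i. p i > 0" and "\<sigma>\<^sup>2 > 0"
    and "\<And>m. xC m \<in> {0, 1}" and "\<And>m. xJ m \<in> {0, 1}" and "\<And>m. xC m + xJ m = 1"
    and "\<And>m. hermitian_psd (V m)"
  shows "invertible (interference_noise_cov p \<sigma> h H xC xJ V k)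
    \<and> (\<forall>u. sinr p \<sigma> h H xC xJ V k u
        \<le> sinr p \<sigma> h H xC xJ V k
            (matrix_inv (interference_noise_cov p \<sigma> h H xC xJ V k)
              *v (mode_selection xC *v h k)))"
proof -
  define S where "S = (mode_selection xC :: complex ^ ('m \<times> 'n) ^ ('m \<times> 'n))"
  define N where "N = interference_cov p h H xJ V k"
  define B where "B = interference_noise_cov p \<sigma> h H xC xJ V k"
  have B_eq: "B = S ** N ** S + \<sigma>\<^sup>2 *\<^sub>R mat 1"
    by (simp add: B_def S_def N_def interference_noise_cov_eq)
  have xJ: "0 \<le> xJ m" for m
    using assms(4)[of m] by auto
  have "hermitian_psd N"
    unfolding N_def using assms(6) xJ less_imp_le[OF assms(1)] by (intro hermitian_psd_interference_cov)
  then have psd: "hermitian_psd (S ** N ** S)"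
    using hermitian_psd_congruence[of N S] by (simp add: S_def conj_transpose_mode_selection)
  have B_psd: "hermitian_psd B"
    unfolding B_eq by (intro hermitian_psd_add psd hermitian_psd_scaleR hermitian_psd_mat_1) simp
  \<comment> \<open>The noise term gives strict positivity even where the form of
    \<open>S ** N ** S\<close> vanishes.\<close>
  have pd: "0 < Re (herm_prod z (B *v z))" if "z \<noteq> 0" for z
  proof -
    have "0 \<le> Re (herm_prod z ((S ** N ** S) *v z))"
      using psd by (simp add: hermitian_psd_def)
    moreover have "0 < \<sigma>\<^sup>2 * Re (herm_prod z z)"
      using assms(2) Re_herm_prod_self_pos[OF that] by (rule mult_pos_pos)
    ultimately show ?thesis
      by (simp add: B_eq matrix_vector_mult_add_rdistrib scaleR_matrix_mult_vector
          herm_prod_add_right herm_prod_scaleR_right)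
  qed
  then have inv: "invertible B"
    by (rule invertible_if_positive_definite)
  define g where "g = S *v h k"
  define w where "w = matrix_inv B *v g"
  have Bw: "B *v w = g"
    using inv by (simp add: w_def matrix_inv_mult_vector)
  have SS: "S *v (S *v x) = S *v x" for x
    unfolding S_def using assms(3) by (rule mode_selection_idem)
  \<comment> \<open>Idempotence absorbs the extra \<open>S\<close> on either side of
    \<open>S ** N ** S\<close>. Since \<open>S\<close> fixes \<open>B *v w\<close>, cancelling
    \<open>B\<close> then shows that it fixes \<open>w\<close>.\<close>
  have "B *v (S *v w) = S *v (B *v w)"
    by (simp add: B_eq matrix_vector_mult_add_rdistrib scaleR_matrix_mult_vector
        matrix_vector_right_distrib SS linear_scale[OF matrix_vector_mul_linear]
        flip: matrix_vector_mul_assoc)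
  also have "\<dots> = B *v w"
    by (simp add: Bw g_def SS)
  finally have Sw: "S *v w = w"
    using matrix_inv_mult_vector(1)[OF inv] by metis
  note Rayleigh = sinr_eq_Rayleigh[of xC _ p \<sigma> h H xJ V k, OF assms(3),
      folded S_def B_def, folded g_def]
  have "sinr p \<sigma> h H xC xJ V k u \<le> sinr p \<sigma> h H xC xJ V k w" for u
  proof (cases "w = 0")
    \<comment> \<open>Here \<open>g = B *v w = 0\<close>, so every SINR is 0, by its numerator or by
      the default value.\<close>
    case True
    then have "g = 0"
      using Bw by simp
    then have "sinr p \<sigma> h H xC xJ V k x = 0" for x
      using Rayleigh[of x] by (cases "S *v x = 0") (simp_all add: sinr_def S_def)
    then show ?thesis
      by simp
  next
    case w: False
    \<comment> \<open>Since \<open>S *v w = w\<close> is nonzero, the default value does not apply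
      at \<open>w\<close>.\<close>
    have sinr_w: "sinr p \<sigma> h H xC xJ V k w
        = p k * ((cmod (herm_prod w (B *v w)))\<^sup>2 / Re (herm_prod w (B *v w)))"
      using Rayleigh[of w] w by (simp add: Sw Bw)
    show ?thesis
    proof (cases "S *v u = 0")
      \<comment> \<open>The default value 0 is harmless because the quotient at \<open>w\<close> is
        nonnegative.\<close>
      case True
      then have "sinr p \<sigma> h H xC xJ V k u = 0"
        by (simp add: sinr_def S_def)
      also have "\<dots> \<le> sinr p \<sigma> h H xC xJ V k w"
        unfolding sinr_w using assms(1)[of k] pd[OF w] by (simp add: less_imp_le)
      finally show ?thesis .
    next
      case u: False
      \<comment> \<open>Writing \<open>g\<close> as \<open>B *v w\<close> makes the numerator a
        value of the form of \<open>B\<close>, as the Rayleigh bound requires.\<close>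
      have "(cmod (herm_prod (S *v u) (B *v w)))\<^sup>2 / Re (herm_prod (S *v u) (B *v (S *v u)))
          \<le> (cmod (herm_prod w (B *v w)))\<^sup>2 / Re (herm_prod w (B *v w))"
        using B_psd pd u w by (rule positive_definite_Rayleigh_le)
      then show ?thesis
        unfolding sinr_w Rayleigh[OF u] Bw
        using assms(1)[of k] by (intro mult_left_mono) (simp_all add: less_imp_le)
    qed
  qed
  then show ?thesis
    using inv by (simp add: B_def w_def g_def S_def)
qed

end
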